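(* Let $X$ be a separable Banach space with the Radon–Nikodým property. Then $n_L(X)=n(X)$.
   Context: $X$ has the Radon–Nikodým property if every Lipschitz function $f:\mathbb{R}\to X$ is differentiable almost everywhere. $\mathrm{Lip}_0(X)$ is the set of Lipschitz maps $T:X\to X$ with $T(0)=0$, with $\|T\|_L=\sup\{\|Tx-Ty\|/\|x-y\|: x\neq y\}$; $D(x)=\{x^*\in X^*: x^*(x)=\|x^*\|\|x\|=\|x\|^2\}$; $\omega(T)=\sup\{|f(Tx-Ty)|/\|x-y\|^2: x\neq y,\ f\in D(x-y)\}$; $n_L(X)=\inf\{\omega(T): T\in\mathrm{Lip}_0(X),\ \|T\|_L=1\}$. The (linear) numerical index is $n(X)=\inf\{\omega(T): T\in L(X),\ \|T\|=1\}$, where $L(X)$ is the space of bounded linear operators on $X$ and, for linear $T$, $\omega(T)=\sup\{|x^*(Tx)|: x\in S_X,\ x^*\in D(x)\}$. *)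

theory Defs
  imports "HOL-Analysis.Analysis"
begin

definition RNP :: "'a::banach itself \<Rightarrow> bool" where
  "RNP _ \<longleftrightarrow> (\<forall>f :: real \<Rightarrow> 'a. (\<exists>C. C-lipschitz_on UNIV f) \<longrightarrow>
      (AE t in lborel. f differentiable (at t)))"

definition duality_set :: "'a::real_normed_vector \<Rightarrow> ('a \<Rightarrow> real) set" where
  "duality_set x = {f. bounded_linear f \<and> f x = onorm f * norm x \<and> onorm f * norm x = (norm x)^2}"

definition Lip0 :: "('a::real_normed_vector \<Rightarrow> 'a) set" where
  "Lip0 = {T. T 0 = 0 \<and> (\<exists>C. C-lipschitz_on UNIV T)}"

text \<open>Lipschitz norm; pairs with x = y contribute 0 (division by zero is 0),
  which does not change the supremum on a nontrivial space (as with onorm).\<close>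
definition lip_norm :: "('a::real_normed_vector \<Rightarrow> 'a) \<Rightarrow> real" where
  "lip_norm T = (SUP p. norm (T (fst p) - T (snd p)) / norm (fst p - snd p))"

definition lip_numrange :: "('a::real_normed_vector \<Rightarrow> 'a) \<Rightarrow> real" where
  "lip_numrange T = Sup {\<bar>f (T x - T y)\<bar> / (norm (x - y))^2 | x y f. f \<in> duality_set (x - y)}"

definition lip_numindex :: "'a::real_normed_vector itself \<Rightarrow> real" where
  "lip_numindex _ = Inf {lip_numrange T | T :: 'a \<Rightarrow> 'a. T \<in> Lip0 \<and> lip_norm T = 1}"

definition lin_numrange :: "('a::real_normed_vector \<Rightarrow> 'a) \<Rightarrow> real" where
  "lin_numrange T = Sup {\<bar>f (T x)\<bar> | x f. norm x = 1 \<and> f \<in> duality_set x}"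

definition numindex :: "'a::real_normed_vector itself \<Rightarrow> real" where
  "numindex _ = Inf {lin_numrange T | T :: 'a \<Rightarrow> 'a. bounded_linear T \<and> onorm T = 1}"

end

theory Submission
  imports Defs
begin

text \<open>Averaging a nonexpansive map \<open>T\<close> along countably many short segments whose directions are
  total gives a nonexpansive map \<open>F\<close> uniformly close to \<open>T\<close>. Averaging along a segment makes a
  Lipschitz map differentiable in the direction of that segment, with a Lipschitz directional
  derivative, and further averaging preserves this; hence \<open>F\<close> is Gateaux differentiable at every point.
  The conditions \<open>\<bar>f (T x - T y)\<bar> \<le> w * (norm (x - y))\<^sup>2\<close> for \<open>f \<in> D(x - y)\<close> are convex, closed and
  translation invariant, so they pass to \<open>F\<close> and then to its derivatives, whose numerical radius is
  therefore at most \<open>\<omega>(T)\<close>. By the mean value inequality some derivative has norm close to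
  \<open>lip_norm T\<close>; normalizing it gives \<open>numindex \<le> lip_numindex\<close>, and the other inequality
  holds because linear operators are Lipschitz.\<close>

subsection \<open>The Hahn-Banach theorem\<close>

definition sublinear :: "('a::real_vector \<Rightarrow> real) \<Rightarrow> bool" where
  "sublinear q \<longleftrightarrow> (\<forall>x y. q (x + y) \<le> q x + q y) \<and> (\<forall>x t. 0 \<le> t \<longrightarrow> q (t *\<^sub>R x) = t * q x)"

lemma sublinear_add: "sublinear q \<Longrightarrow> q (x + y) \<le> q x + q y"
  and sublinear_scaleR: "sublinear q \<Longrightarrow> 0 \<le> t \<Longrightarrow> q (t *\<^sub>R x) = t * q x"
  by (auto simp: sublinear_def)

lemma sublinear_zero: "sublinear q \<Longrightarrow> q 0 = 0"
  using sublinear_scaleR[of q 0 0] by simp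

lemma sublinear_lower: "sublinear q \<Longrightarrow> - q (- x) \<le> q x"
  using sublinear_add[of q x "- x"] sublinear_zero[of q] by simp

text \<open>\<open>shrink q y\<close> is a sublinear minorant of \<open>q\<close> with value at most \<open>- q y\<close> at \<open>- y\<close>;
  a minimal \<open>q\<close> equals all of these, which forces additivity.\<close>

definition shrink :: "('a::real_vector \<Rightarrow> real) \<Rightarrow> 'a \<Rightarrow> 'a \<Rightarrow> real" where
  "shrink q y x = (INF t\<in>{0..}. q (x + t *\<^sub>R y) - t * q y)"

text \<open>The infimum in \<open>shrink\<close> needs a lower bound to be informative;
  subadditivity supplies \<open>- q (- x)\<close>, which does not depend on
  \<open>t\<close>.\<close>

lemma shrink_bdd:
  assumes "sublinear q"
  shows "bdd_below ((\<lambda>t. q (x + t *\<^sub>R y) - t * q y) ` {0..})"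
proof (rule bdd_belowI2)
  fix t :: real assume "t \<in> {0..}"
  then have "t * q y = q ((x + t *\<^sub>R y) + (- x))"
    using sublinear_scaleR[OF assms, of t y] by simp
  also have "\<dots> \<le> q (x + t *\<^sub>R y) + q (- x)"
    by (rule sublinear_add[OF assms])
  finally show "- q (- x) \<le> q (x + t *\<^sub>R y) - t * q y" by simp
qed

lemma shrink_le:
  assumes "sublinear q" "0 \<le> t"
  shows "shrink q y x \<le> q (x + t *\<^sub>R y) - t * q y"
  unfolding shrink_def by (rule cINF_lower[OF shrink_bdd]) (use assms in auto)

lemma le_shrink:
  assumes "\<And>t. 0 \<le> t \<Longrightarrow> m \<le> q (x + t *\<^sub>R y) - t * q y"
  shows "m \<le> shrink q y x"
  unfolding shrink_def by (rule cINF_greatest) (use assms in auto)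

text \<open>Parameters \<open>s\<close> for \<open>a\<close> and \<open>t\<close> for
  \<open>b\<close> combine to \<open>s + t\<close> for \<open>a + b\<close>. Homogeneity comes from
  substituting \<open>r * t\<close> for \<open>t\<close>; one inequality suffices, since applying it
  to \<open>inverse r\<close> gives the reverse one.\<close>

lemma sublinear_shrink:
  assumes q: "sublinear q"
  shows "sublinear (shrink q y)"
proof -
  have add: "shrink q y (a + b) \<le> shrink q y a + shrink q y b" for a b
  proof -
    have *: "shrink q y (a + b) \<le> (q (a + s *\<^sub>R y) - s * q y) + (q (b + t *\<^sub>R y) - t * q y)"
      if "0 \<le> s" "0 \<le> t" for s t
    proof -
      have "shrink q y (a + b) \<le> q (a + b + (s + t) *\<^sub>R y) - (s + t) * q y"
        using that by (intro shrink_le[OF q]) auto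
      also have "a + b + (s + t) *\<^sub>R y = (a + s *\<^sub>R y) + (b + t *\<^sub>R y)"
        by (simp add: algebra_simps)
      also have "q \<dots> \<le> q (a + s *\<^sub>R y) + q (b + t *\<^sub>R y)"
        by (rule sublinear_add[OF q])
      finally show ?thesis by (simp add: algebra_simps)
    qed
    have "shrink q y (a + b) - shrink q y a \<le> shrink q y b"
    proof (rule le_shrink)
      fix t :: real assume t: "0 \<le> t"
      have "shrink q y (a + b) - (q (b + t *\<^sub>R y) - t * q y) \<le> shrink q y a"
        by (rule le_shrink) (use *[OF _ t] in \<open>simp add: algebra_simps\<close>)
      then show "shrink q y (a + b) - shrink q y a \<le> q (b + t *\<^sub>R y) - t * q y" by simp
    qed
    then show ?thesis by simp
  qed
  have le: "shrink q y (r *\<^sub>R x) \<le> r * shrink q y x" if "0 < r" for r x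
  proof -
    have "shrink q y (r *\<^sub>R x) / r \<le> shrink q y x"
    proof (rule le_shrink)
      fix t :: real assume t: "0 \<le> t"
      have "shrink q y (r *\<^sub>R x) \<le> q (r *\<^sub>R x + (r * t) *\<^sub>R y) - r * t * q y"
        using that t by (intro shrink_le[OF q]) auto
      also have "r *\<^sub>R x + (r * t) *\<^sub>R y = r *\<^sub>R (x + t *\<^sub>R y)"
        by (simp add: algebra_simps)
      also have "q \<dots> = r * q (x + t *\<^sub>R y)"
        using that by (intro sublinear_scaleR[OF q]) auto
      finally have "shrink q y (r *\<^sub>R x) \<le> (q (x + t *\<^sub>R y) - t * q y) * r"
        by (simp add: algebra_simps)
      then show "shrink q y (r *\<^sub>R x) / r \<le> q (x + t *\<^sub>R y) - t * q y"
        using that by (simp add: pos_divide_le_eq)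
    qed
    then show ?thesis using that by (simp add: pos_divide_le_eq mult.commute)
  qed
  have scale: "shrink q y (r *\<^sub>R x) = r * shrink q y x" if "0 < r" for r x
  proof (rule antisym)
    have "shrink q y (inverse r *\<^sub>R (r *\<^sub>R x)) \<le> inverse r * shrink q y (r *\<^sub>R x)"
      by (rule le) (use that in simp)
    then show "r * shrink q y x \<le> shrink q y (r *\<^sub>R x)"
      using that by (simp add: field_simps)
  qed (rule le[OF that])
  have "shrink q y 0 = 0"
  proof (rule antisym)
    show "shrink q y 0 \<le> 0"
      using shrink_le[OF q order_refl, of y 0] sublinear_zero[OF q] by simp
    show "0 \<le> shrink q y 0"
      by (rule le_shrink) (use sublinear_scaleR[OF q] in simp)
  qed
  with scale have "shrink q y (r *\<^sub>R x) = r * shrink q y x" if "0 \<le> r" for r x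
    using that by (cases "r = 0") auto
  with add show ?thesis by (simp add: sublinear_def)
qed

lemma minimal_sublinear_linear:
  assumes q: "sublinear q" and min: "\<And>r. sublinear r \<Longrightarrow> r \<le> q \<Longrightarrow> r = q"
  shows "linear q"
proof -
  have "shrink q y \<le> q" for y
    using shrink_le[OF q order_refl, of y] by (simp add: le_fun_def)
  then have "shrink q y = q" for y
    using min sublinear_shrink[OF q] by blast
  \<comment> \<open>The parameter \<open>t = 1\<close> gives superadditivity, the half of additivity
    that sublinearity does not provide.\<close>
  then have "q x \<le> q (x + y) - q y" for x y
    using shrink_le[OF q, of 1 y x] by simp
  then have add: "q (x + y) = q x + q y" for x y
    using sublinear_add[OF q, of x y] by (simp add: add.commute antisym le_diff_eq)
  have neg: "q (- x) = - q x" for x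
    using add[of x "- x"] sublinear_zero[OF q] by simp
  have "q (r *\<^sub>R x) = r * q x" for r x
  proof (cases "0 \<le> r")
    case False
    then have "q (- ((- r) *\<^sub>R x)) = r * q x"
      unfolding neg using sublinear_scaleR[OF q, of "- r" x] by simp
    then show ?thesis by simp
  qed (simp add: sublinear_scaleR[OF q])
  with add show ?thesis by (intro linearI) auto
qed

text \<open>Of two members of a chain one lies below the other, so subadditivity of the smaller one
  bounds the infimum at \<open>x + y\<close> by every mixed sum \<open>q x + r y\<close>.\<close>

lemma sublinear_INF_chain:
  assumes "C \<noteq> {}" and sub: "\<And>q. q \<in> C \<Longrightarrow> sublinear q"
    and le: "\<And>q. q \<in> C \<Longrightarrow> q \<le> p"
    and chain: "\<And>q r. q \<in> C \<Longrightarrow> r \<in> C \<Longrightarrow> q \<le> r \<or> r \<le> q"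
  shows "sublinear (\<lambda>x. INF q\<in>C. q x)" and "q \<in> C \<Longrightarrow> (INF q\<in>C. q x) \<le> q x"
proof -
  have bdd: "bdd_below ((\<lambda>q. q x) ` C)" for x
  proof (rule bdd_belowI2)
    fix q assume "q \<in> C"
    then show "- p (- x) \<le> q x"
      using sublinear_lower[OF sub, of q x] le_funD[OF le, of q "- x"] by simp
  qed
  show low: "q \<in> C \<Longrightarrow> (INF q\<in>C. q x) \<le> q x" for q x
    by (rule cINF_lower[OF bdd])
  have add: "(INF q\<in>C. q (x + y)) \<le> (INF q\<in>C. q x) + (INF q\<in>C. q y)" for x y
  proof -
    have *: "(INF q\<in>C. q (x + y)) \<le> q x + r y" if qr: "q \<in> C" "r \<in> C" for q r
    proof -
      obtain m where m: "m \<in> C" "m \<le> q" "m \<le> r"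
        using chain[OF qr] qr by blast
      have "(INF q\<in>C. q (x + y)) \<le> m (x + y)" by (rule low[OF m(1)])
      also have "\<dots> \<le> m x + m y" by (rule sublinear_add[OF sub[OF m(1)]])
      also have "\<dots> \<le> q x + r y" using m(2,3) by (auto simp: le_fun_def intro: add_mono)
      finally show ?thesis .
    qed
    have "(INF q\<in>C. q (x + y)) - (INF q\<in>C. q x) \<le> (INF r\<in>C. r y)"
    proof (rule cINF_greatest[OF \<open>C \<noteq> {}\<close>])
      fix r assume r: "r \<in> C"
      have "(INF q\<in>C. q (x + y)) - r y \<le> (INF q\<in>C. q x)"
        by (rule cINF_greatest[OF \<open>C \<noteq> {}\<close>]) (use *[OF _ r] in \<open>simp add: algebra_simps\<close>)
      then show "(INF q\<in>C. q (x + y)) - (INF q\<in>C. q x) \<le> r y" by simp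
    qed
    then show ?thesis by simp
  qed
  have le: "(INF q\<in>C. q (r *\<^sub>R x)) \<le> r * (INF q\<in>C. q x)" if "0 < r" for r x
  proof -
    have "(INF q\<in>C. q (r *\<^sub>R x)) / r \<le> (INF q\<in>C. q x)"
    proof (rule cINF_greatest[OF \<open>C \<noteq> {}\<close>])
      fix q assume q: "q \<in> C"
      have "(INF q\<in>C. q (r *\<^sub>R x)) \<le> r * q x"
        using low[OF q, of "r *\<^sub>R x"] sublinear_scaleR[OF sub[OF q], of r x] that by simp
      then show "(INF q\<in>C. q (r *\<^sub>R x)) / r \<le> q x"
        using that by (simp add: pos_divide_le_eq mult.commute)
    qed
    then show ?thesis using that by (simp add: pos_divide_le_eq mult.commute)
  qed
  have scale: "(INF q\<in>C. q (r *\<^sub>R x)) = r * (INF q\<in>C. q x)" if "0 < r" for r x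
  proof (rule antisym)
    have "(INF q\<in>C. q (inverse r *\<^sub>R (r *\<^sub>R x))) \<le> inverse r * (INF q\<in>C. q (r *\<^sub>R x))"
      by (rule le) (use that in simp)
    then show "r * (INF q\<in>C. q x) \<le> (INF q\<in>C. q (r *\<^sub>R x))"
      using that by (simp add: field_simps)
  qed (rule le[OF that])
  have "(INF q\<in>C. q 0) = (0::real)"
    using \<open>C \<noteq> {}\<close> INF_cong[of C C "\<lambda>q. q 0" "\<lambda>q. 0"] sublinear_zero[OF sub] by simp
  with scale have "(INF q\<in>C. q (r *\<^sub>R x)) = r * (INF q\<in>C. q x)" if "0 \<le> r" for r x
    using that by (cases "r = 0") auto
  with add show "sublinear (\<lambda>x. INF q\<in>C. q x)" by (simp add: sublinear_def)
qed

text \<open>Zorn's lemma yields a minimal sublinear functional below \<open>p\<close>, which is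
  linear. No subspace is involved: constraints on \<open>f\<close> are encoded in the choice of
  \<open>p\<close>.\<close>

lemma linear_below_sublinear:
  assumes p: "sublinear p"
  obtains f where "linear f" "f \<le> p"
proof -
  let ?A = "{q. sublinear q \<and> q \<le> p}"
  \<comment> \<open>The order is reversed, so that the maximal element from Zorn's lemma is minimal
    in the pointwise order.\<close>
  let ?P = "\<lambda>q r :: 'a \<Rightarrow> real. r \<le> q"
  have "\<exists>m\<in>?A. \<forall>a\<in>?A. ?P m a \<longrightarrow> a = m"
  proof (rule predicate_Zorn)
    show "partial_order_on ?A (relation_of ?P ?A)"
      by (rule partial_order_on_relation_ofI) auto
  next
    fix C assume "C \<in> Chains (relation_of ?P ?A)"
    then have C: "\<And>q. q \<in> C \<Longrightarrow> sublinear q" "\<And>q. q \<in> C \<Longrightarrow> q \<le> p"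
      "\<And>q r. q \<in> C \<Longrightarrow> r \<in> C \<Longrightarrow> q \<le> r \<or> r \<le> q"
      by (auto simp: Chains_def relation_of_def)
    show "\<exists>u\<in>?A. \<forall>a\<in>C. ?P a u"
    proof (cases "C = {}")
      case True
      with p show ?thesis by auto
    next
      case False
      have inf: "sublinear (\<lambda>x. INF q\<in>C. q x)"
        using C by (rule sublinear_INF_chain(1)[OF False])
      have low: "(\<lambda>x. INF q\<in>C. q x) \<le> q" if "q \<in> C" for q
        using sublinear_INF_chain(2)[OF False, of p q] C that by (simp add: le_fun_def)
      moreover from False obtain q where "q \<in> C" by blast
      ultimately have "(\<lambda>x. INF q\<in>C. q x) \<le> p"
        using C(2) order_trans by blast
      with inf low show ?thesis by blast
    qed
  qed
  then obtain m where "sublinear m" "m \<le> p" "\<And>a. sublinear a \<Longrightarrow> a \<le> m \<Longrightarrow> a = m"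
    by (auto intro: order_trans)
  with minimal_sublinear_linear[of m] that show thesis by blast
qed

text \<open>Lying below \<open>shrink ?p x\<close> gives both
  \<open>f v \<le> norm x * norm v\<close> and \<open>f (- x) \<le> - (norm x * norm x)\<close>;
  together they force \<open>f x = norm x * norm x\<close>.\<close>

lemma duality_set_nonempty: "duality_set x \<noteq> {}"
proof -
  let ?p = "\<lambda>v. norm x * norm v"
  have p: "sublinear ?p"
    by (auto simp: sublinear_def distrib_left[symmetric] intro!: mult_left_mono norm_triangle_ineq)
  obtain f where f: "linear f" "f \<le> shrink ?p x"
    using linear_below_sublinear[OF sublinear_shrink[OF p]] by blast
  have f_le: "f v \<le> norm x * norm v" for v
    using le_funD[OF f(2), of v] shrink_le[OF p order_refl, of x v] by simp
  have "f (- x) \<le> - (norm x * norm x)"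
    using le_funD[OF f(2), of "- x"] shrink_le[OF p, of 1 x "- x"] by simp
  then have fx: "f x = norm x * norm x"
    using f_le[of x] linear_neg[OF f(1), of x] by simp
  have abs: "norm (f v) \<le> norm x * norm v" for v
    using f_le[of v] f_le[of "- v"] linear_neg[OF f(1), of v] by (simp add: abs_le_iff)
  have bl: "bounded_linear f"
    by (rule bounded_linear_intro[where K = "norm x"])
       (use f(1) abs in \<open>auto simp: linear_add linear_scale mult.commute\<close>)
  have "onorm f \<le> norm x"
    by (rule onorm_bound[OF _ abs]) simp
  moreover have "norm x * norm x \<le> onorm f * norm x"
    using onorm[OF bl, of x] fx by simp
  \<comment> \<open>The products are compared without cancelling \<open>norm x\<close>, so
    \<open>x = 0\<close> needs no separate case.\<close>
  ultimately have "onorm f * norm x = norm x * norm x"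
    by (meson antisym mult_right_mono norm_ge_zero)
  with bl fx have "f \<in> duality_set x"
    by (auto simp add: duality_set_def power2_eq_square)
  then show ?thesis by blast
qed

subsection \<open>Averages along segments\<close>

definition segment_mean :: "'a::real_normed_vector \<Rightarrow> ('a \<Rightarrow> 'b::banach) \<Rightarrow> 'a \<Rightarrow> 'b" where
  "segment_mean v h z = integral {0..1} (\<lambda>s. h (z + s *\<^sub>R v))"

lemma lipschitz_continuous_on_line:
  fixes h :: "'a::real_normed_vector \<Rightarrow> 'b::real_normed_vector"
  assumes "L-lipschitz_on UNIV h"
  shows "continuous_on S (\<lambda>s::real. h (z + s *\<^sub>R v))"
proof -
  have "continuous_on UNIV h" by (rule lipschitz_on_continuous_on[OF assms])
  then show ?thesis
    by (rule continuous_on_compose2) (intro continuous_intros, simp)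
qed

lemma norm_lipschitz:
  fixes h :: "'a::real_normed_vector \<Rightarrow> 'b::real_normed_vector"
  assumes "L-lipschitz_on UNIV h"
  shows "norm (h x - h y) \<le> L * norm (x - y)"
  using lipschitz_onD[OF assms, of x y] by (simp add: dist_norm)

lemma norm_lipschitzI:
  fixes h :: "'a::real_normed_vector \<Rightarrow> 'b::real_normed_vector"
  assumes "0 \<le> L" "\<And>x y. norm (h x - h y) \<le> L * norm (x - y)"
  shows "L-lipschitz_on UNIV h"
  using assms by (auto intro!: lipschitz_onI simp: dist_norm)

text \<open>A bound valid for all translates survives averaging over them, because \<open>A\<close>
  commutes with the integral. This general shape serves Lipschitz estimates (\<open>r = 0\<close>,
  \<open>A\<close> the identity), numerical range conditions (\<open>r = 0\<close>, \<open>A\<close>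
  a functional) and first order expansions (\<open>r = t\<close>).\<close>

lemma segment_mean_diff_bound:
  fixes h g :: "'a::real_normed_vector \<Rightarrow> 'b::banach" and A :: "'b \<Rightarrow> 'c::banach"
  assumes h: "L-lipschitz_on UNIV h" and g: "L'-lipschitz_on UNIV g"
    and A: "bounded_linear A"
    and le: "\<And>w. norm (A (h (a + w) - h (b + w) - r *\<^sub>R g (c + w))) \<le> m"
  shows "norm (A (segment_mean v h a - segment_mean v h b - r *\<^sub>R segment_mean v g c)) \<le> m"
proof -
  let ?k = "\<lambda>s. h (a + s *\<^sub>R v) - h (b + s *\<^sub>R v) - r *\<^sub>R g (c + s *\<^sub>R v)"
  have cont: "continuous_on {0..1} ?k"
    by (intro continuous_intros lipschitz_continuous_on_line[OF h] lipschitz_continuous_on_line[OF g])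
  have hi: "(\<lambda>s. h (z + s *\<^sub>R v)) integrable_on {0..1}"
    and gi: "(\<lambda>s. g (z + s *\<^sub>R v)) integrable_on {0..1}" for z
    by (intro integrable_continuous_real lipschitz_continuous_on_line[OF h]
        lipschitz_continuous_on_line[OF g])+
  have "integral {0..1} ?k = segment_mean v h a - segment_mean v h b - r *\<^sub>R segment_mean v g c"
    unfolding segment_mean_def
    by (simp add: integral_diff integrable_diff hi gi integrable_cmul)
  then have "A (segment_mean v h a - segment_mean v h b - r *\<^sub>R segment_mean v g c)
      = integral {0..1} (\<lambda>s. A (?k s))"
    using integral_linear[OF integrable_continuous_real[OF cont] A] by (simp add: o_def)
  moreover have "norm (integral {0..1} (\<lambda>s. A (?k s))) \<le> m * (1 - 0)"
    by (intro integral_bound bounded_linear.continuous_on[OF A] cont) (simp_all add: le)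
  ultimately show ?thesis by simp
qed

lemma segment_mean_lipschitz:
  assumes h: "L-lipschitz_on UNIV h"
  shows "L-lipschitz_on UNIV (segment_mean v h)"
proof (rule norm_lipschitzI[OF lipschitz_on_nonneg[OF h]])
  fix x y
  have "norm (h (x + w) - h (y + w)) \<le> L * norm (x - y)" for w
    using norm_lipschitz[OF h, of "x + w" "y + w"] by simp
  then show "norm (segment_mean v h x - segment_mean v h y) \<le> L * norm (x - y)"
    using segment_mean_diff_bound[OF h h bounded_linear_ident, of x y 0] by simp
qed

lemma segment_mean_near:
  assumes h: "L-lipschitz_on UNIV h"
  shows "norm (segment_mean v h z - h z) \<le> L * norm v"
proof -
  have "norm (integral {0..1} (\<lambda>s. h (z + s *\<^sub>R v) - h z)) \<le> L * norm v * (1 - 0)"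
  proof (intro integral_bound continuous_intros lipschitz_continuous_on_line[OF h])
    fix s :: real assume s: "s \<in> {0..1}"
    have "norm (h (z + s *\<^sub>R v) - h z) \<le> L * (\<bar>s\<bar> * norm v)"
      using norm_lipschitz[OF h, of "z + s *\<^sub>R v" z] by simp
    also have "\<dots> \<le> L * norm v"
      using s lipschitz_on_nonneg[OF h] by (intro mult_left_mono mult_left_le_one_le) auto
    finally show "norm (h (z + s *\<^sub>R v) - h z) \<le> L * norm v" .
  qed simp
  moreover have "integral {0..1} (\<lambda>s. h (z + s *\<^sub>R v) - h z) = segment_mean v h z - h z"
    unfolding segment_mean_def
    by (subst integral_diff)
       (auto intro!: integrable_continuous_real lipschitz_continuous_on_line[OF h])
  ultimately show ?thesis by simp
qed

section \<open>Directional derivatives with a uniform quadratic remainder\<close>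

text \<open>Lipschitz continuity of \<open>G\<close> is what allows derivatives in two directions to
  be added. One remainder constant for all \<open>z\<close> is the form that passes to averages over
  translates.\<close>

definition lip_dir_deriv ::
    "('a::real_normed_vector \<Rightarrow> 'b::real_normed_vector) \<Rightarrow> 'a \<Rightarrow> ('a \<Rightarrow> 'b) \<Rightarrow> bool" where
  "lip_dir_deriv F e G \<longleftrightarrow> (\<exists>L. L-lipschitz_on UNIV G) \<and>
     (\<exists>C. \<forall>z t. norm (F (z + t *\<^sub>R e) - F z - t *\<^sub>R G z) \<le> C * t\<^sup>2)"

text \<open>The bound for \<open>t < 0\<close> follows from the one for \<open>t > 0\<close> at the shifted base point.\<close>

lemma lip_dir_derivI:
  assumes G: "L-lipschitz_on UNIV G" and C: "0 \<le> C"
    and le: "\<And>z t. 0 \<le> t \<Longrightarrow> norm (F (z + t *\<^sub>R e) - F z - t *\<^sub>R G z) \<le> C * t\<^sup>2"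
  shows "lip_dir_deriv F e G"
proof -
  have "norm (F (z + t *\<^sub>R e) - F z - t *\<^sub>R G z) \<le> (C + L * norm e) * t\<^sup>2" for z t
  proof (cases "0 \<le> t")
    case True
    have "C * t\<^sup>2 \<le> (C + L * norm e) * t\<^sup>2"
      using lipschitz_on_nonneg[OF G] by (intro mult_right_mono) auto
    with le[OF True] show ?thesis using order_trans by blast
  next
    case False
    define y where "y = z + t *\<^sub>R e"
    have z: "z = y + (- t) *\<^sub>R e" by (simp add: y_def)
    have "F (z + t *\<^sub>R e) - F z - t *\<^sub>R G z
        = - (F (y + (- t) *\<^sub>R e) - F y - (- t) *\<^sub>R G y) + t *\<^sub>R (G y - G z)"
      unfolding z[symmetric] y_def[symmetric] by (simp add: algebra_simps)
    also have "norm \<dots> \<le> C * (- t)\<^sup>2 + \<bar>t\<bar> * (L * (\<bar>t\<bar> * norm e))"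
    proof (rule norm_triangle_le, rule add_mono)
      show "norm (- (F (y + - t *\<^sub>R e) - F y - - t *\<^sub>R G y)) \<le> C * (- t)\<^sup>2"
        unfolding norm_minus_cancel using False by (intro le) simp
      have "norm (G y - G z) \<le> L * (\<bar>t\<bar> * norm e)"
        using norm_lipschitz[OF G, of y z] by (simp add: y_def)
      then show "norm (t *\<^sub>R (G y - G z)) \<le> \<bar>t\<bar> * (L * (\<bar>t\<bar> * norm e))"
        by (simp add: mult_left_mono)
    qed
    also have "\<dots> = (C + L * norm e) * t\<^sup>2"
      by (simp add: algebra_simps power2_eq_square flip: abs_mult)
    finally show ?thesis .
  qed
  with G show ?thesis unfolding lip_dir_deriv_def by blast
qed

lemma lipschitz_translate_diff:
  fixes h :: "'a::real_normed_vector \<Rightarrow> 'b::real_normed_vector"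
  assumes h: "L-lipschitz_on UNIV h"
  shows "(2 * L)-lipschitz_on UNIV (\<lambda>z. h (z + v) - h z)"
proof (rule norm_lipschitzI)
  fix x y
  have "norm (h (x + v) - h x - (h (y + v) - h y))
      \<le> norm (h (x + v) - h (y + v)) + norm (h x - h y)"
    using norm_triangle_ineq4[of "h (x + v) - h (y + v)" "h x - h y"] by (simp add: algebra_simps)
  also have "\<dots> \<le> 2 * L * norm (x - y)"
    using norm_lipschitz[OF h, of "x + v" "y + v"] norm_lipschitz[OF h, of x y] by simp
  finally show "norm (h (x + v) - h x - (h (y + v) - h y)) \<le> 2 * L * norm (x - y)" .
qed (use lipschitz_on_nonneg[OF h] in simp)

text \<open>Along the line through \<open>z\<close> the mean is the integral of \<open>g\<close>
  over a window of length 1. Moving the window by \<open>t\<close> adds a piece at one end and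
  removes one at the other, so to first order the change is \<open>t\<close> times
  \<open>g 1 - g 0\<close>.\<close>

lemma segment_mean_lip_dir_deriv:
  assumes h: "L-lipschitz_on UNIV h"
  shows "lip_dir_deriv (segment_mean v h) v (\<lambda>z. h (z + v) - h z)"
proof (rule lip_dir_derivI[OF lipschitz_translate_diff[OF h]])
  show "0 \<le> 2 * (L * norm v)" using lipschitz_on_nonneg[OF h] by simp
  fix z and t :: real assume t: "0 \<le> t"
  define g where "g s = h (z + s *\<^sub>R v)" for s
  have gc: "continuous_on S g" for S
    unfolding g_def by (rule lipschitz_continuous_on_line[OF h])
  then have gi: "g integrable_on {a..b}" for a b
    by (rule integrable_continuous_real)
  have g_lip: "norm (g r - g s) \<le> L * (\<bar>r - s\<bar> * norm v)" for r s
    using norm_lipschitz[OF h, of "z + r *\<^sub>R v" "z + s *\<^sub>R v"]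
    by (simp add: g_def flip: scaleR_diff_left)
  \<comment> \<open>A piece of length \<open>t\<close> is compared with \<open>g\<close> frozen at
    its left endpoint; \<open>g\<close> varies by at most \<open>L * (t * norm v)\<close> there,
    whence the quadratic error.\<close>
  have err: "norm (integral {a..a + t} g - t *\<^sub>R g a) \<le> L * norm v * t\<^sup>2" for a
  proof -
    have "norm (integral {a..a + t} (\<lambda>s. g s - g a)) \<le> L * (t * norm v) * (a + t - a)"
    proof (intro integral_bound continuous_intros gc)
      fix s assume "s \<in> {a..a + t}"
      then have "L * (\<bar>s - a\<bar> * norm v) \<le> L * (t * norm v)"
        using lipschitz_on_nonneg[OF h] by (intro mult_left_mono mult_right_mono) auto
      with g_lip[of s a] show "norm (g s - g a) \<le> L * (t * norm v)" by linarith
    qed (use t in auto)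
    moreover have "integral {a..a + t} (\<lambda>s. g s - g a) = integral {a..a + t} g - t *\<^sub>R g a"
      using t gi by (subst integral_diff) auto
    ultimately show ?thesis by (simp add: power2_eq_square algebra_simps)
  qed
  have "segment_mean v h (z + t *\<^sub>R v) = integral {0..1} (\<lambda>s. g (s + t))"
    by (simp add: segment_mean_def g_def algebra_simps)
  also have "\<dots> = integral {t..1 + t} g"
    using integral_shift_real_ivl[of t t "1 + t" g] by simp
  finally have "segment_mean v h (z + t *\<^sub>R v) - segment_mean v h z
      = integral {t..1 + t} g - integral {0..1} g"
    by (simp add: segment_mean_def g_def[abs_def])
  \<comment> \<open>Both windows are compared through the interval \<open>{0..1 + t}\<close>, so
    they need not overlap and \<open>t > 1\<close> is allowed.\<close>
  also have "\<dots> = integral {1..1 + t} g - integral {0..0 + t} g"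
    using Henstock_Kurzweil_Integration.integral_combine[OF _ _ gi, of 0 t "1 + t"]
      Henstock_Kurzweil_Integration.integral_combine[OF _ _ gi, of 0 1 "1 + t"] t
    by (simp add: algebra_simps)
  finally have "segment_mean v h (z + t *\<^sub>R v) - segment_mean v h z - t *\<^sub>R (h (z + v) - h z)
      = (integral {1..1 + t} g - t *\<^sub>R g 1) - (integral {0..0 + t} g - t *\<^sub>R g 0)"
    by (simp add: g_def algebra_simps)
  also have "norm \<dots> \<le> L * norm v * t\<^sup>2 + L * norm v * t\<^sup>2"
    by (intro order_trans[OF norm_triangle_ineq4] add_mono err)
  finally show "norm (segment_mean v h (z + t *\<^sub>R v) - segment_mean v h z - t *\<^sub>R (h (z + v) - h z))
      \<le> 2 * (L * norm v) * t\<^sup>2" by simp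
qed

section \<open>Iterated averages and their limit\<close>

primrec iterated_mean ::
    "(nat \<Rightarrow> 'a::real_normed_vector) \<Rightarrow> ('a \<Rightarrow> 'b::banach) \<Rightarrow> nat \<Rightarrow> 'a \<Rightarrow> 'b" where
  "iterated_mean v h 0 = h"
| "iterated_mean v h (Suc n) = segment_mean (v n) (iterated_mean v h n)"

lemma iterated_mean_lipschitz:
  "L-lipschitz_on UNIV h \<Longrightarrow> L-lipschitz_on UNIV (iterated_mean v h n)"
  by (induction n) (auto intro: segment_mean_lipschitz)

lemma iterated_mean_shift:
  "iterated_mean v h (n + k) = iterated_mean (\<lambda>i. v (i + k)) (iterated_mean v h k) n"
  by (induction n) auto

lemma iterated_mean_diff_bound:
  fixes h g :: "'a::real_normed_vector \<Rightarrow> 'b::banach" and A :: "'b \<Rightarrow> 'c::banach"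
  assumes h: "L-lipschitz_on UNIV h" and g: "L'-lipschitz_on UNIV g"
    and A: "bounded_linear A"
    and le: "\<And>w. norm (A (h (a + w) - h (b + w) - r *\<^sub>R g (c + w))) \<le> m"
  shows "norm (A (iterated_mean v h n a - iterated_mean v h n b - r *\<^sub>R iterated_mean v g n c)) \<le> m"
proof -
  \<comment> \<open>All translates \<open>w\<close> are treated at once, since an averaging step at
    \<open>w\<close> uses the previous bound at other translates.\<close>
  have "norm (A (iterated_mean v h n (a + w) - iterated_mean v h n (b + w)
      - r *\<^sub>R iterated_mean v g n (c + w))) \<le> m" for w
  proof (induction n arbitrary: w)
    case (Suc n)
    show ?case
      unfolding iterated_mean.simps
      by (rule segment_mean_diff_bound[OF iterated_mean_lipschitz[OF h] iterated_mean_lipschitz[OF g] A])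
         (use Suc in \<open>simp add: add.assoc\<close>)
  qed (simp add: le)
  from this[of 0] show ?thesis by simp
qed

definition limit_mean ::
    "(nat \<Rightarrow> 'a::real_normed_vector) \<Rightarrow> ('a \<Rightarrow> 'b::banach) \<Rightarrow> 'a \<Rightarrow> 'b" where
  "limit_mean v h z = lim (\<lambda>n. iterated_mean v h n z)"

text \<open>The Lipschitz constant \<open>L\<close> is kept at every stage, so averaging along
  \<open>v n\<close> moves each value by at most \<open>L * norm (v n)\<close>. The telescoping
  series therefore converges absolutely, and its sum bounds the total displacement.\<close>

lemma iterated_mean_convergence:
  assumes h: "L-lipschitz_on UNIV h" and v: "summable (\<lambda>i. norm (v i))"
  shows iterated_mean_tendsto: "(\<lambda>n. iterated_mean v h n z) \<longlonglongrightarrow> limit_mean v h z"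
    and limit_mean_near: "norm (limit_mean v h z - h z) \<le> L * (\<Sum>i. norm (v i))"
proof -
  let ?d = "\<lambda>n. iterated_mean v h (Suc n) z - iterated_mean v h n z"
  have le: "norm (?d n) \<le> L * norm (v n)" for n
    using segment_mean_near[OF iterated_mean_lipschitz[OF h]] by simp
  have sm: "summable (\<lambda>i. L * norm (v i))" by (rule summable_mult[OF v])
  have nd: "summable (\<lambda>n. norm (?d n))"
    by (rule summable_comparison_test'[OF sm]) (use le in simp)
  have "(\<lambda>n. \<Sum>i<n. ?d i) \<longlonglongrightarrow> suminf ?d"
    by (rule summable_LIMSEQ[OF summable_norm_cancel[OF nd]])
  then have "(\<lambda>n. iterated_mean v h n z - h z) \<longlonglongrightarrow> suminf ?d"
    unfolding sum_lessThan_telescope[of "\<lambda>n. iterated_mean v h n z"] iterated_mean.simps(1) .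
  from tendsto_add[OF this tendsto_const[of "h z"]]
  have lim: "(\<lambda>n. iterated_mean v h n z) \<longlonglongrightarrow> suminf ?d + h z" by simp
  then have eq: "limit_mean v h z = suminf ?d + h z"
    unfolding limit_mean_def by (rule limI)
  with lim show "(\<lambda>n. iterated_mean v h n z) \<longlonglongrightarrow> limit_mean v h z" by simp
  have "norm (suminf ?d) \<le> (\<Sum>n. norm (?d n))" by (rule summable_norm[OF nd])
  also have "\<dots> \<le> (\<Sum>i. L * norm (v i))" by (rule suminf_le[OF le nd sm])
  also have "\<dots> = L * (\<Sum>i. norm (v i))" by (rule suminf_mult[OF v])
  finally show "norm (limit_mean v h z - h z) \<le> L * (\<Sum>i. norm (v i))" by (simp add: eq)
qed

lemma limit_mean_diff_bound:
  fixes h g :: "'a::real_normed_vector \<Rightarrow> 'b::banach" and A :: "'b \<Rightarrow> 'c::banach"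
  assumes h: "L-lipschitz_on UNIV h" and g: "L'-lipschitz_on UNIV g"
    and v: "summable (\<lambda>i. norm (v i))" and A: "bounded_linear A"
    and le: "\<And>w. norm (A (h (a + w) - h (b + w) - r *\<^sub>R g (c + w))) \<le> m"
  shows "norm (A (limit_mean v h a - limit_mean v h b - r *\<^sub>R limit_mean v g c)) \<le> m"
proof (rule LIMSEQ_le_const2)
  show "(\<lambda>n. norm (A (iterated_mean v h n a - iterated_mean v h n b - r *\<^sub>R iterated_mean v g n c)))
      \<longlonglongrightarrow> norm (A (limit_mean v h a - limit_mean v h b - r *\<^sub>R limit_mean v g c))"
    by (intro tendsto_norm bounded_linear.tendsto[OF A] tendsto_intros
        iterated_mean_tendsto[OF h v] iterated_mean_tendsto[OF g v])
qed (use iterated_mean_diff_bound[OF h g A le] in blast)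

lemma limit_mean_lipschitz:
  assumes h: "L-lipschitz_on UNIV h" and v: "summable (\<lambda>i. norm (v i))"
  shows "L-lipschitz_on UNIV (limit_mean v h)"
proof (rule norm_lipschitzI[OF lipschitz_on_nonneg[OF h]])
  fix x y
  have "norm (h (x + w) - h (y + w)) \<le> L * norm (x - y)" for w
    using norm_lipschitz[OF h, of "x + w" "y + w"] by simp
  then show "norm (limit_mean v h x - limit_mean v h y) \<le> L * norm (x - y)"
    using limit_mean_diff_bound[OF h h v bounded_linear_ident, of x y 0] by simp
qed

lemma limit_mean_shift:
  assumes h: "L-lipschitz_on UNIV h" and v: "summable (\<lambda>i. norm (v i))"
  shows "limit_mean v h = limit_mean (\<lambda>i. v (i + k)) (iterated_mean v h k)"
proof
  fix z
  have "(\<lambda>n. iterated_mean v h (n + k) z) \<longlonglongrightarrow> limit_mean v h z"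
    by (rule LIMSEQ_ignore_initial_segment[OF iterated_mean_tendsto[OF h v]])
  then show "limit_mean v h z = limit_mean (\<lambda>i. v (i + k)) (iterated_mean v h k) z"
    unfolding iterated_mean_shift limit_mean_def[of "\<lambda>i. v (i + k)"] by (rule limI[symmetric])
qed

text \<open>Averaging along \<open>v k\<close> creates a derivative \<open>g\<close> in that
  direction. The later averagings act on the map and on \<open>g\<close> alike and preserve the
  remainder bound, so the limit has the averaged \<open>g\<close> as derivative.\<close>

lemma limit_mean_lip_dir_deriv:
  assumes h: "L-lipschitz_on UNIV h" and v: "summable (\<lambda>i. norm (v i))"
  shows "\<exists>G. lip_dir_deriv (limit_mean v h) (v k) G"
proof -
  let ?v = "\<lambda>i. v (i + Suc k)" and ?H = "iterated_mean v h (Suc k)"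
  have sv: "summable (\<lambda>i. norm (?v i))"
    using v by (rule summable_ignore_initial_segment)
  have H: "L-lipschitz_on UNIV ?H" by (rule iterated_mean_lipschitz[OF h])
  obtain g L' C where g: "L'-lipschitz_on UNIV g"
    and C: "\<And>z t. norm (?H (z + t *\<^sub>R v k) - ?H z - t *\<^sub>R g z) \<le> C * t\<^sup>2"
    using segment_mean_lip_dir_deriv[OF iterated_mean_lipschitz[OF h, of v k], of "v k"]
    unfolding lip_dir_deriv_def iterated_mean.simps by blast
  have "norm (limit_mean ?v ?H (z + t *\<^sub>R v k) - limit_mean ?v ?H z - t *\<^sub>R limit_mean ?v g z)
      \<le> C * t\<^sup>2" for z t
    by (rule limit_mean_diff_bound[OF H g sv bounded_linear_ident])
       (use C[of "z + w" for w] in \<open>simp add: add.assoc add.commute[of "t *\<^sub>R v k"]\<close>)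
  then have "lip_dir_deriv (limit_mean ?v ?H) (v k) (limit_mean ?v g)"
    unfolding lip_dir_deriv_def using limit_mean_lipschitz[OF g sv] by blast
  then show ?thesis using limit_mean_shift[OF h v, of "Suc k"] by auto
qed

subsection \<open>Gateaux derivatives\<close>

lemma lip_dir_deriv_scaleR:
  assumes "lip_dir_deriv F e G"
  shows "lip_dir_deriv F (r *\<^sub>R e) (\<lambda>z. r *\<^sub>R G z)"
proof -
  from assms obtain L C where G: "L-lipschitz_on UNIV G"
    and C: "\<And>z t. norm (F (z + t *\<^sub>R e) - F z - t *\<^sub>R G z) \<le> C * t\<^sup>2"
    unfolding lip_dir_deriv_def by blast
  have "norm (F (z + t *\<^sub>R r *\<^sub>R e) - F z - t *\<^sub>R r *\<^sub>R G z) \<le> (C * r\<^sup>2) * t\<^sup>2" for z t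
    using C[of z "t * r"] by (simp add: power_mult_distrib mult_ac)
  with lipschitz_on_cmult[OF G, of r] show ?thesis unfolding lip_dir_deriv_def by blast
qed

text \<open>The displacement is made first along \<open>e\<close>, then along the second direction.
  The second expansion has base point \<open>?y\<close> instead of \<open>z\<close>; correcting this
  by the Lipschitz bound costs another multiple of \<open>t\<^sup>2\<close>.\<close>

lemma lip_dir_deriv_add:
  assumes "lip_dir_deriv F e G" "lip_dir_deriv F e' G'"
  shows "lip_dir_deriv F (e + e') (\<lambda>z. G z + G' z)"
proof -
  from assms(1) obtain L C where G: "L-lipschitz_on UNIV G"
    and C: "\<And>z t. norm (F (z + t *\<^sub>R e) - F z - t *\<^sub>R G z) \<le> C * t\<^sup>2"
    unfolding lip_dir_deriv_def by blast
  from assms(2) obtain L' C' where G': "L'-lipschitz_on UNIV G'"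
    and C': "\<And>z t. norm (F (z + t *\<^sub>R e') - F z - t *\<^sub>R G' z) \<le> C' * t\<^sup>2"
    unfolding lip_dir_deriv_def by blast
  have "norm (F (z + t *\<^sub>R (e + e')) - F z - t *\<^sub>R (G z + G' z)) \<le> (C + C' + L' * norm e) * t\<^sup>2" for z t
  proof -
    let ?y = "z + t *\<^sub>R e"
    have "F (z + t *\<^sub>R (e + e')) - F z - t *\<^sub>R (G z + G' z)
        = (F ?y - F z - t *\<^sub>R G z) + (F (?y + t *\<^sub>R e') - F ?y - t *\<^sub>R G' ?y) + t *\<^sub>R (G' ?y - G' z)"
      by (simp add: algebra_simps)
    also have "norm \<dots> \<le> C * t\<^sup>2 + C' * t\<^sup>2 + \<bar>t\<bar> * (L' * (\<bar>t\<bar> * norm e))"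
    proof (intro norm_triangle_mono C C')
      have "norm (G' ?y - G' z) \<le> L' * (\<bar>t\<bar> * norm e)"
        using norm_lipschitz[OF G', of ?y z] by simp
      then show "norm (t *\<^sub>R (G' ?y - G' z)) \<le> \<bar>t\<bar> * (L' * (\<bar>t\<bar> * norm e))"
        by (simp add: mult_left_mono)
    qed
    also have "\<dots> = (C + C' + L' * norm e) * t\<^sup>2"
      by (simp add: algebra_simps power2_eq_square flip: abs_mult)
    finally show ?thesis .
  qed
  with lipschitz_on_add[OF G G'] show ?thesis unfolding lip_dir_deriv_def by blast
qed

lemma lip_dir_deriv_tendsto:
  assumes "lip_dir_deriv F e G"
  shows "((\<lambda>t. (F (z + t *\<^sub>R e) - F z) /\<^sub>R t) \<longlongrightarrow> G z) (at 0)"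
proof -
  from assms obtain C where
    C: "\<And>z t. norm (F (z + t *\<^sub>R e) - F z - t *\<^sub>R G z) \<le> C * t\<^sup>2"
    unfolding lip_dir_deriv_def by blast
  have "norm ((F (z + t *\<^sub>R e) - F z) /\<^sub>R t - G z) \<le> C * \<bar>t\<bar>" if "t \<noteq> 0" for t
  proof -
    have "(F (z + t *\<^sub>R e) - F z) /\<^sub>R t - G z = (F (z + t *\<^sub>R e) - F z - t *\<^sub>R G z) /\<^sub>R t"
      using that by (simp add: algebra_simps)
    also have "norm \<dots> \<le> C * t\<^sup>2 / \<bar>t\<bar>"
      using divide_right_mono[OF C[of z t], of "\<bar>t\<bar>"]
      by (simp add: divide_inverse abs_inverse mult.commute)
    also have "\<dots> = C * \<bar>t\<bar>"
      using that by (cases "0 \<le> t") (auto simp: power2_eq_square)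
    finally show ?thesis .
  qed
  then have "\<forall>\<^sub>F t in at 0. norm ((F (z + t *\<^sub>R e) - F z) /\<^sub>R t - G z) \<le> C * \<bar>t\<bar>"
    by (auto simp: eventually_at_filter)
  moreover have "((\<lambda>t. C * \<bar>t\<bar>) \<longlongrightarrow> 0) (at 0)"
    by (auto intro!: tendsto_eq_intros)
  ultimately have "((\<lambda>t. (F (z + t *\<^sub>R e) - F z) /\<^sub>R t - G z) \<longlongrightarrow> 0) (at 0)"
    by (rule Lim_null_comparison)
  then show ?thesis by (rule LIM_zero_cancel)
qed

definition gateaux_deriv ::
    "('a::real_normed_vector \<Rightarrow> 'b::real_normed_vector) \<Rightarrow> ('a \<Rightarrow> 'b) \<Rightarrow> 'a \<Rightarrow> bool" where
  "gateaux_deriv F S z \<longleftrightarrow> bounded_linear S \<and>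
     (\<forall>v. ((\<lambda>t. (F (z + t *\<^sub>R v) - F z) /\<^sub>R t) \<longlongrightarrow> S v) (at 0))"

text \<open>The bound is uniform in \<open>t\<close>, which lets convergence on a dense set of
  directions extend to all directions.\<close>

lemma difference_quotient_lipschitz:
  fixes F :: "'a::real_normed_vector \<Rightarrow> 'b::real_normed_vector"
  assumes F: "L-lipschitz_on UNIV F" and t: "t \<noteq> 0"
  shows "norm ((F (z + t *\<^sub>R u) - F z) /\<^sub>R t - (F (z + t *\<^sub>R v) - F z) /\<^sub>R t) \<le> L * norm (u - v)"
proof -
  have "(F (z + t *\<^sub>R u) - F z) /\<^sub>R t - (F (z + t *\<^sub>R v) - F z) /\<^sub>R t
      = (F (z + t *\<^sub>R u) - F (z + t *\<^sub>R v)) /\<^sub>R t"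
    by (simp add: algebra_simps)
  moreover have "norm (F (z + t *\<^sub>R u) - F (z + t *\<^sub>R v)) \<le> L * norm (u - v) * \<bar>t\<bar>"
    using norm_lipschitz[OF F, of "z + t *\<^sub>R u" "z + t *\<^sub>R v"]
    by (simp add: mult_ac flip: scaleR_diff_right)
  then have "norm (F (z + t *\<^sub>R u) - F (z + t *\<^sub>R v)) / \<bar>t\<bar> \<le> L * norm (u - v)"
    using t by (simp add: pos_divide_le_eq)
  ultimately show ?thesis
    by (simp add: divide_inverse abs_inverse mult.commute)
qed

text \<open>The directions with a derivative form a subspace on which the derivative at
  \<open>z\<close> is linear and \<open>L\<close>-Lipschitz. It extends to the closure by
  completeness of the target, and the equi-Lipschitz difference quotients converge to the
  extension.\<close>

lemma gateaux_deriv_exists: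
  fixes F :: "'a::real_normed_vector \<Rightarrow> 'b::banach"
  assumes F: "L-lipschitz_on UNIV F"
    and dense: "closure {e. \<exists>G. lip_dir_deriv F e G} = UNIV"
  shows "\<exists>S. gateaux_deriv F S z"
proof -
  define V where "V = {e. \<exists>G. lip_dir_deriv F e G}"
  define q where "q t v = (F (z + t *\<^sub>R v) - F z) /\<^sub>R t" for t v
  \<comment> \<open>The choice of \<open>G\<close> is arbitrary, but its value at \<open>z\<close>
    is a limit of difference quotients and hence does not depend on it.\<close>
  define S0 where "S0 v = (SOME G. lip_dir_deriv F v G) z" for v
  have some: "lip_dir_deriv F v (SOME G. lip_dir_deriv F v G)" if "v \<in> V" for v
    using that someI_ex[of "lip_dir_deriv F v"] by (simp add: V_def)
  have lim: "((\<lambda>t. q t v) \<longlongrightarrow> S0 v) (at 0)" if "v \<in> V" for v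
    unfolding q_def S0_def by (rule lip_dir_deriv_tendsto[OF some[OF that]])
  have q_lip: "norm (q t u - q t v) \<le> L * norm (u - v)" if "t \<noteq> 0" for t u v
    unfolding q_def by (rule difference_quotient_lipschitz[OF F that])
  have S0_eq: "S0 v = G z" if "lip_dir_deriv F v G" for v G
  proof -
    have "v \<in> V" using that by (auto simp: V_def)
    from tendsto_unique[OF _ lim[OF this] lip_dir_deriv_tendsto[OF that, of z, folded q_def]]
    show ?thesis by simp
  qed
  have S0_add: "u + v \<in> V \<and> S0 (u + v) = S0 u + S0 v" if "u \<in> V" "v \<in> V" for u v
  proof -
    note sum = lip_dir_deriv_add[OF some[OF that(1)] some[OF that(2)]]
    from sum S0_eq[OF sum] show ?thesis unfolding V_def S0_def by blast
  qed
  have S0_scale: "r *\<^sub>R u \<in> V \<and> S0 (r *\<^sub>R u) = r *\<^sub>R S0 u" if "u \<in> V" for r u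
  proof -
    note scaled = lip_dir_deriv_scaleR[OF some[OF that], of r]
    from scaled S0_eq[OF scaled] show ?thesis unfolding V_def S0_def by blast
  qed
  have S0_lip: "L-lipschitz_on V S0"
  proof (rule lipschitz_onI[OF _ lipschitz_on_nonneg[OF F]])
    fix u v assume uv: "u \<in> V" "v \<in> V"
    have "((\<lambda>t. norm (q t u - q t v)) \<longlongrightarrow> norm (S0 u - S0 v)) (at 0)"
      by (intro tendsto_intros lim uv)
    then show "dist (S0 u) (S0 v) \<le> L * dist u v"
      unfolding dist_norm
      by (rule tendsto_upperbound) (auto simp: eventually_at_filter q_lip)
  qed
  obtain S where S: "L-lipschitz_on UNIV S" and S_eq: "\<And>v. v \<in> V \<Longrightarrow> S v = S0 v"
    using lipschitz_extend_closure[OF S0_lip] dense by (auto simp: V_def)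
  have cont: "continuous_on UNIV S" by (rule lipschitz_on_continuous_on[OF S])
  have V_dense: "closure V = UNIV" using dense by (simp add: V_def)
  have add: "S (u + v) = S u + S v" for u v
  proof -
    have "closed {p. S (fst p + snd p) = S (fst p) + S (snd p)}"
      by (intro closed_Collect_eq continuous_intros continuous_on_compose2[OF cont]) auto
    moreover have "V \<times> V \<subseteq> {p. S (fst p + snd p) = S (fst p) + S (snd p)}"
      using S0_add S_eq by auto
    ultimately have "closure (V \<times> V) \<subseteq> {p. S (fst p + snd p) = S (fst p) + S (snd p)}"
      by (intro closure_minimal)
    moreover have "(u, v) \<in> closure (V \<times> V)" by (simp add: closure_Times V_dense)
    ultimately show ?thesis by auto
  qed
  have scale: "S (r *\<^sub>R u) = r *\<^sub>R S u" for r u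
  proof -
    have "closed {u. S (r *\<^sub>R u) = r *\<^sub>R S u}"
      by (intro closed_Collect_eq continuous_intros continuous_on_compose2[OF cont]) auto
    moreover have "V \<subseteq> {u. S (r *\<^sub>R u) = r *\<^sub>R S u}"
      using S0_scale S_eq by auto
    ultimately have "closure V \<subseteq> {u. S (r *\<^sub>R u) = r *\<^sub>R S u}"
      by (intro closure_minimal)
    then show ?thesis by (auto simp: V_dense)
  qed
  have S0: "S 0 = 0" using scale[of 0 0] by simp
  have "bounded_linear S"
    by (rule bounded_linear_intro[where K = L])
       (use add scale norm_lipschitz[OF S, of _ 0] S0 in \<open>auto simp: mult.commute\<close>)
  moreover have "((\<lambda>t. q t v) \<longlongrightarrow> S v) (at 0)" for v
  proof (rule tendstoI)
    fix \<epsilon> :: real assume "0 < \<epsilon>"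
    \<comment> \<open>Using \<open>L + 1\<close> covers \<open>L = 0\<close> and makes the two
      Lipschitz errors add up to strictly less than \<open>\<epsilon>\<close>.\<close>
    define \<delta> where "\<delta> = \<epsilon> / (2 * (L + 1))"
    have L: "0 \<le> L" by (rule lipschitz_on_nonneg[OF F])
    have "0 < \<delta>" using \<open>0 < \<epsilon>\<close> L by (simp add: \<delta>_def)
    then obtain u where u: "u \<in> V" "dist u v < \<delta>"
      using V_dense closure_approachable[of v V] by auto
    have "L * norm (u - v) \<le> L * \<delta>"
      using u(2) L by (intro mult_left_mono) (auto simp: dist_norm)
    moreover have "2 * (L * \<delta>) < \<epsilon>"
      using \<open>0 < \<epsilon>\<close> L by (simp add: \<delta>_def field_simps)
    ultimately have gap: "0 < \<epsilon> - 2 * (L * norm (u - v))" by linarith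
    have "\<forall>\<^sub>F t in at 0. dist (q t u) (S0 u) < \<epsilon> - 2 * (L * norm (u - v))"
      by (rule tendstoD[OF lim[OF u(1)] gap])
    moreover have "\<forall>\<^sub>F t in at (0::real). t \<noteq> 0"
      by (simp add: eventually_at_filter)
    ultimately show "\<forall>\<^sub>F t in at 0. dist (q t v) (S v) < \<epsilon>"
    proof eventually_elim
      case (elim t)
      have "q t v - S v = (q t v - q t u) + (q t u - S u) + (S u - S v)" by simp
      then have "norm (q t v - S v) \<le> norm (q t v - q t u) + norm (q t u - S u) + norm (S u - S v)"
        by (metis norm_triangle_mono order_refl)
      moreover have "norm (q t v - q t u) \<le> L * norm (u - v)"
        using q_lip[OF elim(2), of v u] by (simp add: norm_minus_commute)
      moreover have "norm (S u - S v) \<le> L * norm (u - v)"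
        by (rule norm_lipschitz[OF S])
      ultimately show ?case
        using elim(1) S_eq[OF u(1)] by (simp add: dist_norm)
    qed
  qed
  ultimately show ?thesis unfolding gateaux_deriv_def q_def by blast
qed

text \<open>Only derivatives along the segment from \<open>y\<close> to \<open>x\<close> enter, so
  Gateaux differentiability is enough: \<open>\<phi>\<close> is a differentiable curve in one real
  variable.\<close>

lemma mean_value_gateaux:
  fixes F :: "'a::real_normed_vector \<Rightarrow> 'b::real_normed_vector"
  assumes S: "\<And>z. gateaux_deriv F (S z) z" and B: "\<And>z. onorm (S z) \<le> B"
  shows "norm (F x - F y) \<le> B * norm (x - y)"
proof -
  define \<phi> where "\<phi> s = F (y + s *\<^sub>R (x - y))" for s :: real
  have "(\<phi> has_vector_derivative S (y + s *\<^sub>R (x - y)) (x - y)) (at s within {0..1})" for s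
  proof -
    have "((\<lambda>t. (F (y + s *\<^sub>R (x - y) + t *\<^sub>R (x - y)) - F (y + s *\<^sub>R (x - y))) /\<^sub>R t)
        \<longlongrightarrow> S (y + s *\<^sub>R (x - y)) (x - y)) (at 0)"
      using S unfolding gateaux_deriv_def by blast
    then have "((\<lambda>t. (\<phi> (s + t) - \<phi> s) /\<^sub>R t) \<longlongrightarrow> S (y + s *\<^sub>R (x - y)) (x - y)) (at 0)"
      by (simp add: \<phi>_def scaleR_add_left add.assoc)
    then have "((\<lambda>t. norm ((\<phi> (s + t) - \<phi> s) /\<^sub>R t - S (y + s *\<^sub>R (x - y)) (x - y))) \<longlongrightarrow> 0) (at 0)"
      by (intro tendsto_norm_zero LIM_zero)
    moreover have "norm ((\<phi> (s + t) - \<phi> s) /\<^sub>R t - d) = norm (\<phi> (s + t) - \<phi> s - t *\<^sub>R d) / norm t"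
      if "t \<noteq> 0" for t d
    proof -
      have "(\<phi> (s + t) - \<phi> s) /\<^sub>R t - d = (\<phi> (s + t) - \<phi> s - t *\<^sub>R d) /\<^sub>R t"
        using that by (simp add: algebra_simps)
      then show ?thesis by (simp add: divide_inverse abs_inverse mult.commute)
    qed
    ultimately have "((\<lambda>t. norm (\<phi> (s + t) - \<phi> s - t *\<^sub>R S (y + s *\<^sub>R (x - y)) (x - y)) / norm t)
        \<longlongrightarrow> 0) (at 0)"
      by (simp cong: LIM_cong)
    then have "(\<phi> has_vector_derivative S (y + s *\<^sub>R (x - y)) (x - y)) (at s)"
      unfolding has_vector_derivative_def has_derivative_at
      by (simp add: bounded_linear_scaleR_left)
    then show ?thesis by (rule has_vector_derivative_at_within)
  qed
  moreover have "norm (S (y + s *\<^sub>R (x - y)) (x - y)) \<le> B * norm (x - y)" for s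
  proof -
    have "bounded_linear (S (y + s *\<^sub>R (x - y)))" using S unfolding gateaux_deriv_def by blast
    from onorm[OF this, of "x - y"] mult_right_mono[OF B norm_ge_zero] show ?thesis
      by (rule order_trans)
  qed
  ultimately have "norm (\<phi> 1 - \<phi> 0) \<le> B * norm (x - y) * norm (1 - 0 :: real)"
    by (intro differentiable_bound[where S = "{0..1}"])
       (auto simp: has_vector_derivative_def mult.commute[of _ "\<bar>_\<bar>"] intro!: onorm_le mult_left_mono)
  then show ?thesis by (simp add: \<phi>_def)
qed

subsection \<open>Numerical ranges\<close>

text \<open>Rescaling points by nonzero factors keeps the lines they span, so the lengths can be
  made summable with small total while the lines still cover \<open>S\<close>.\<close>

lemma small_dense_directions:
  fixes S :: "'a::real_normed_vector set"
  assumes "countable S" "closure S = UNIV" "0 < \<delta>"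
  obtains v :: "nat \<Rightarrow> 'a" where "summable (\<lambda>i. norm (v i))" "(\<Sum>i. norm (v i)) \<le> \<delta>"
    "closure {r *\<^sub>R v i | r i. True} = UNIV"
proof -
  have "S \<noteq> {}" using assms(2) by auto
  define e where "e = from_nat_into S"
  have e: "range e = S"
    unfolding e_def by (rule range_from_nat_into[OF \<open>S \<noteq> {}\<close> assms(1)])
  \<comment> \<open>The denominator never vanishes and exceeds \<open>norm (e i)\<close>; the
    remaining geometric factors sum to \<open>\<delta>\<close>.\<close>
  define c where "c i = \<delta> * (1/2) ^ Suc i / (1 + norm (e i))" for i
  define v where "v i = c i *\<^sub>R e i" for i
  have c: "0 < c i" for i
    using \<open>0 < \<delta>\<close> by (simp add: c_def add_pos_nonneg)
  have bound: "norm (v i) \<le> \<delta> * (1/2) ^ Suc i" for i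
  proof -
    have "norm (v i) = c i * norm (e i)"
      using c[of i] by (simp add: v_def)
    also have "\<dots> = (\<delta> * (1/2) ^ Suc i) * (norm (e i) / (1 + norm (e i)))"
      by (simp add: c_def)
    also have "\<dots> \<le> (\<delta> * (1/2) ^ Suc i) * 1"
      using \<open>0 < \<delta>\<close> by (intro mult_left_mono) (auto simp: divide_le_eq_1 add_pos_nonneg)
    finally show ?thesis by simp
  qed
  have sums: "(\<lambda>i. \<delta> * (1/2) ^ Suc i) sums \<delta>"
    using sums_mult[OF power_half_series, of \<delta>] by simp
  have sm: "summable (\<lambda>i. norm (v i))"
    by (rule summable_comparison_test'[OF sums_summable[OF sums]]) (use bound in simp)
  moreover have "(\<Sum>i. norm (v i)) \<le> \<delta>"
    using suminf_le[OF bound sm sums_summable[OF sums]] sums_unique[OF sums] by simp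
  moreover have "S \<subseteq> {r *\<^sub>R v i | r i. True}"
  proof
    fix x assume "x \<in> S"
    then obtain i where "x = e i" using e by auto
    then have "x = inverse (c i) *\<^sub>R v i" using c[of i] by (simp add: v_def)
    then show "x \<in> {r *\<^sub>R v i | r i. True}" by blast
  qed
  then have "closure {r *\<^sub>R v i | r i. True} = UNIV"
    using closure_mono assms(2) by blast
  ultimately show thesis by (rule that)
qed

section \<open>Numerical range conditions under averaging and differentiation\<close>

text \<open>Negative \<open>r\<close> is included, as the two-sided limit in a Gateaux derivative
  requires.\<close>

lemma duality_set_scaleR:
  assumes "f \<in> duality_set x"
  shows "(\<lambda>v. r * f v) \<in> duality_set (r *\<^sub>R x)"
proof -
  from assms have f: "bounded_linear f" "f x = onorm f * norm x" "onorm f * norm x = (norm x)\<^sup>2"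
    by (auto simp: duality_set_def)
  have "onorm (\<lambda>v. r * f v) = \<bar>r\<bar> * onorm f"
    using onorm_scaleR[OF f(1), of r] by simp
  then show ?thesis
    using f bounded_linear_const_mult[OF f(1), of r] linear_scale[OF bounded_linear.linear[OF f(1)]]
    by (cases "0 \<le> r") (auto simp: duality_set_def power2_eq_square)
qed

text \<open>At \<open>x = 0\<close> the duality set contains every bounded linear functional, so the
  bound is claimed only away from it.\<close>

lemma duality_set_norm_le:
  assumes "f \<in> duality_set x" "x \<noteq> 0"
  shows "\<bar>f v\<bar> \<le> norm x * norm v"
proof -
  from assms have "bounded_linear f" "onorm f = norm x"
    by (auto simp: duality_set_def power2_eq_square)
  with onorm[of f v] show ?thesis by simp
qed

text \<open>Stands for \<open>\<omega>(h) \<le> w\<close>, avoiding the quotient and the supremum.\<close>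

definition numrange_le :: "('a::real_normed_vector \<Rightarrow> 'a) \<Rightarrow> real \<Rightarrow> bool" where
  "numrange_le h w \<longleftrightarrow> (\<forall>x y. \<forall>f\<in>duality_set (x - y). \<bar>f (h x - h y)\<bar> \<le> w * (norm (x - y))\<^sup>2)"

text \<open>The points \<open>x + u\<close> and \<open>y + u\<close> have the same difference and
  hence the same functionals, so for fixed \<open>f\<close> the condition is a bound uniform over
  translates.\<close>

lemma limit_mean_numrange_le:
  fixes h :: "'a::banach \<Rightarrow> 'a"
  assumes h: "L-lipschitz_on UNIV h" and v: "summable (\<lambda>i. norm (v i))" and w: "numrange_le h w"
  shows "numrange_le (limit_mean v h) w"
  unfolding numrange_le_def
proof (intro allI ballI)
  fix x y :: 'a and f assume f: "f \<in> duality_set (x - y)"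
  then have A: "bounded_linear f" by (simp add: duality_set_def)
  have "norm (f (h (x + u) - h (y + u))) \<le> w * (norm (x - y))\<^sup>2" for u
    using w[unfolded numrange_le_def, rule_format, where x="x + u" and y="y + u" and f=f] f by simp
  then show "\<bar>f (limit_mean v h x - limit_mean v h y)\<bar> \<le> w * (norm (x - y))\<^sup>2"
    using limit_mean_diff_bound[OF h h v A, of x y 0] by simp
qed

text \<open>For the pair \<open>z + t *\<^sub>R v\<close>, \<open>z\<close> the functional
  \<open>t * f\<close> is admissible; dividing by \<open>t\<^sup>2\<close> turns the condition into
  a bound on difference quotients.\<close>

lemma gateaux_deriv_numrange_le:
  assumes S: "gateaux_deriv F S z" and w: "numrange_le F w" and f: "f \<in> duality_set v"
  shows "\<bar>f (S v)\<bar> \<le> w * (norm v)\<^sup>2"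
proof (rule tendsto_upperbound)
  have A: "bounded_linear f" using f by (simp add: duality_set_def)
  have "((\<lambda>t. (F (z + t *\<^sub>R v) - F z) /\<^sub>R t) \<longlongrightarrow> S v) (at 0)"
    using S by (simp add: gateaux_deriv_def)
  then show "((\<lambda>t. \<bar>f ((F (z + t *\<^sub>R v) - F z) /\<^sub>R t)\<bar>) \<longlongrightarrow> \<bar>f (S v)\<bar>) (at 0)"
    by (intro tendsto_rabs bounded_linear.tendsto[OF A])
  have "\<bar>f ((F (z + t *\<^sub>R v) - F z) /\<^sub>R t)\<bar> \<le> w * (norm v)\<^sup>2" if "t \<noteq> 0" for t
  proof -
    have "\<bar>t * f (F (z + t *\<^sub>R v) - F z)\<bar> \<le> w * (norm (z + t *\<^sub>R v - z))\<^sup>2"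
      using w[unfolded numrange_le_def, rule_format, of "\<lambda>u. t * f u" "z + t *\<^sub>R v" z]
        duality_set_scaleR[OF f, of t] by simp
    also have "t * f (F (z + t *\<^sub>R v) - F z) = t\<^sup>2 * f ((F (z + t *\<^sub>R v) - F z) /\<^sub>R t)"
      using that linear_scale[OF bounded_linear.linear[OF A]] by (simp add: power2_eq_square)
    also have "w * (norm (z + t *\<^sub>R v - z))\<^sup>2 = t\<^sup>2 * (w * (norm v)\<^sup>2)"
      by (simp add: power_mult_distrib)
    finally show ?thesis using that by (simp add: abs_mult)
  qed
  then show "\<forall>\<^sub>F t in at 0. \<bar>f ((F (z + t *\<^sub>R v) - F z) /\<^sub>R t)\<bar> \<le> w * (norm v)\<^sup>2"
    by (simp add: eventually_at_filter)
qed simp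

text \<open>If all derivatives of the averaged map \<open>F\<close> had norm at most
  \<open>c\<close>, the mean value inequality would contradict the slope of \<open>T\<close> between
  \<open>x\<close> and \<open>y\<close>, which \<open>F\<close> nearly inherits.\<close>

lemma linear_with_large_norm:
  fixes T :: "'a::banach \<Rightarrow> 'a"
  assumes sep: "countable D" "closure D = (UNIV :: 'a set)"
    and T: "1-lipschitz_on UNIV T" and w: "numrange_le T w"
    and c: "c * norm (x - y) < norm (T x - T y)"
  obtains S :: "'a \<Rightarrow> 'a" where "bounded_linear S" "c < onorm S"
    "\<And>v f. f \<in> duality_set v \<Longrightarrow> \<bar>f (S v)\<bar> \<le> w * (norm v)\<^sup>2"
proof -
  \<comment> \<open>Displacing both values by at most \<open>\<delta>\<close> uses
    \<open>2 * \<delta>\<close> of the gap \<open>4 * \<delta>\<close>, so a strict inequality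
    remains.\<close>
  define \<delta> where "\<delta> = (norm (T x - T y) - c * norm (x - y)) / 4"
  have "0 < \<delta>" using c by (simp add: \<delta>_def)
  obtain v :: "nat \<Rightarrow> 'a" where v: "summable (\<lambda>i. norm (v i))" "(\<Sum>i. norm (v i)) \<le> \<delta>"
    and dense: "closure {r *\<^sub>R v i | r i. True} = UNIV"
    by (rule small_dense_directions[OF sep \<open>0 < \<delta>\<close>])
  define F where "F = limit_mean v T"
  have F: "1-lipschitz_on UNIV F"
    unfolding F_def by (rule limit_mean_lipschitz[OF T v(1)])
  have "\<exists>G. lip_dir_deriv F (r *\<^sub>R v i) G" for r i
    using limit_mean_lip_dir_deriv[OF T v(1), of i] unfolding F_def
    by (auto dest: lip_dir_deriv_scaleR)
  then have "{r *\<^sub>R v i | r i. True} \<subseteq> {e. \<exists>G. lip_dir_deriv F e G}" by auto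
  from closure_mono[OF this] dense have "closure {e. \<exists>G. lip_dir_deriv F e G} = UNIV" by auto
  from gateaux_deriv_exists[OF F this]
  obtain S where S: "\<And>z. gateaux_deriv F (S z) z" by metis
  have "\<exists>z. c < onorm (S z)"
  proof (rule ccontr)
    assume "\<nexists>z. c < onorm (S z)"
    then have "norm (F x - F y) \<le> c * norm (x - y)"
      by (intro mean_value_gateaux[OF S]) (simp add: not_less)
    moreover have near: "norm (F z - T z) \<le> \<delta>" for z
      using limit_mean_near[OF T v(1), of z] v(2) by (simp add: F_def)
    have "norm (T x - T y) \<le> norm (F x - F y) + norm (F x - T x) + norm (F y - T y)"
      using norm_triangle_ineq4[of "F x - F y" "(F x - T x) - (F y - T y)"]
        norm_triangle_ineq4[of "F x - T x" "F y - T y"] by (simp add: algebra_simps)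
    ultimately show False
      using near[of x] near[of y] \<open>0 < \<delta>\<close> by (simp add: \<delta>_def)
  qed
  then obtain z where "c < onorm (S z)" ..
  moreover have "bounded_linear (S z)" using S by (simp add: gateaux_deriv_def)
  moreover have "numrange_le F w"
    unfolding F_def by (rule limit_mean_numrange_le[OF T v(1) w])
  then have "\<bar>f (S z v)\<bar> \<le> w * (norm v)\<^sup>2" if "f \<in> duality_set v" for v f
    using gateaux_deriv_numrange_le[OF S] that by blast
  ultimately show thesis using that by blast
qed

section \<open>Comparison of the suprema and of the two indices\<close>

lemma lip_numrange_bdd:
  fixes T :: "'a::real_normed_vector \<Rightarrow> 'a"
  assumes T: "L-lipschitz_on UNIV T"
  shows "bdd_above {\<bar>f (T x - T y)\<bar> / (norm (x - y))\<^sup>2 | x y f. f \<in> duality_set (x - y)}"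
proof (rule bdd_aboveI, clarify)
  fix x y :: 'a and f assume f: "f \<in> duality_set (x - y)"
  show "\<bar>f (T x - T y)\<bar> / (norm (x - y))\<^sup>2 \<le> L"
  proof (cases "x = y")
    case False
    have "\<bar>f (T x - T y)\<bar> \<le> norm (x - y) * norm (T x - T y)"
      using f False by (intro duality_set_norm_le) auto
    also have "\<dots> \<le> norm (x - y) * (L * norm (x - y))"
      by (intro mult_left_mono norm_lipschitz[OF T]) simp
    finally show ?thesis
      using False by (simp add: pos_divide_le_eq power2_eq_square mult_ac)
  \<comment> \<open>On the diagonal the quotient is \<open>0\<close>, by division by zero.\<close>
  qed (use lipschitz_on_nonneg[OF T] in simp)
qed

lemma numrange_le_lip_numrange:
  fixes T :: "'a::real_normed_vector \<Rightarrow> 'a"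
  assumes T: "L-lipschitz_on UNIV T"
  shows "numrange_le T (lip_numrange T)"
  unfolding numrange_le_def
proof (intro allI ballI)
  fix x y :: 'a and f assume f: "f \<in> duality_set (x - y)"
  show "\<bar>f (T x - T y)\<bar> \<le> lip_numrange T * (norm (x - y))\<^sup>2"
  proof (cases "x = y")
    case True
    have "bounded_linear f" using f by (simp add: duality_set_def)
    with True show ?thesis by (simp add: linear_0 bounded_linear.linear)
  next
    case False
    have "\<bar>f (T x - T y)\<bar> / (norm (x - y))\<^sup>2 \<le> lip_numrange T"
      unfolding lip_numrange_def by (rule cSup_upper[OF _ lip_numrange_bdd[OF T]]) (use f in blast)
    then show ?thesis using False by (simp add: pos_divide_le_eq)
  qed
qed

text \<open>The pair of points \<open>0\<close>, \<open>0\<close> already contributes the value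
  \<open>0\<close>, so even the trivial space is covered.\<close>

lemma lip_numrange_nonneg:
  fixes T :: "'a::real_normed_vector \<Rightarrow> 'a"
  assumes T: "L-lipschitz_on UNIV T"
  shows "0 \<le> lip_numrange T"
proof -
  obtain f :: "'a \<Rightarrow> real" where "f \<in> duality_set (0 - 0)"
    using duality_set_nonempty[of "0 - 0"] by blast
  then have "\<bar>f (T 0 - T 0)\<bar> / (norm (0 - 0 :: 'a))\<^sup>2 \<le> lip_numrange T"
    unfolding lip_numrange_def by (intro cSup_upper[OF _ lip_numrange_bdd[OF T]]) blast
  then show ?thesis by simp
qed

lemma lin_numrange_bdd:
  assumes S: "bounded_linear S"
  shows "bdd_above {\<bar>f (S x)\<bar> | x f. norm x = 1 \<and> f \<in> duality_set x}"
proof (rule bdd_aboveI, clarify)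
  fix x :: 'a and f assume x: "norm x = 1" and f: "f \<in> duality_set x"
  have "\<bar>f (S x)\<bar> \<le> norm x * norm (S x)"
    using f x by (intro duality_set_norm_le) auto
  also have "\<dots> \<le> onorm S"
    using onorm[OF S, of x] x by simp
  finally show "\<bar>f (S x)\<bar> \<le> onorm S" .
qed

lemma le_lin_numrange:
  assumes "bounded_linear S" "norm x = 1" "f \<in> duality_set x"
  shows "\<bar>f (S x)\<bar> \<le> lin_numrange S"
  unfolding lin_numrange_def
  by (rule cSup_upper[OF _ lin_numrange_bdd[OF assms(1)]]) (use assms in blast)

lemma unit_vector_with_duality:
  fixes u :: "'a::real_normed_vector"
  assumes "u \<noteq> 0"
  obtains x :: 'a and f where "norm x = 1" "f \<in> duality_set x"
  using that[of "u /\<^sub>R norm u"] duality_set_nonempty[of "u /\<^sub>R norm u"] assms by auto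

text \<open>The trivial space has no unit vectors, which would leave \<open>lin_numrange\<close>
  with the supremum of the empty set; a nonzero operator norm excludes this space.\<close>

lemma onorm_nonzero_obtains_nonzero:
  fixes S :: "'a::real_normed_vector \<Rightarrow> 'b::real_normed_vector"
  assumes "onorm S \<noteq> 0" "S 0 = 0"
  obtains u :: 'a where "u \<noteq> 0"
proof -
  have "\<exists>u :: 'a. u \<noteq> 0"
  proof (rule ccontr)
    assume "\<nexists>u :: 'a. u \<noteq> 0"
    then have "S = (\<lambda>_. 0)" using assms(2) by (metis ext)
    then show False using assms(1) onorm_zero by metis
  qed
  then show thesis using that by blast
qed

lemma lin_numrange_nonneg:
  assumes S: "bounded_linear S" and "onorm S \<noteq> 0"
  shows "0 \<le> lin_numrange S"
proof -
  obtain u :: 'a where "u \<noteq> 0"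
    using onorm_nonzero_obtains_nonzero[OF assms(2)] linear_0[OF bounded_linear.linear[OF S]] by blast
  then obtain x :: 'a and f where "norm x = 1" "f \<in> duality_set x"
    by (rule unit_vector_with_duality)
  from le_lin_numrange[OF S this] show ?thesis by linarith
qed

text \<open>By linearity only \<open>x - y\<close> matters, and scaling it and \<open>f\<close> by
  \<open>inverse (norm (x - y))\<close> moves it to the unit sphere without changing the quotient.
  Diagonal pairs contribute \<open>0\<close>, hence the use of nonnegativity.\<close>

lemma lip_numrange_le_lin_numrange:
  assumes S: "bounded_linear S" and nz: "onorm S \<noteq> 0"
  shows "lip_numrange S \<le> lin_numrange S"
  unfolding lip_numrange_def
proof (rule cSup_least)
  show "{\<bar>f (S x - S y)\<bar> / (norm (x - y))\<^sup>2 |x y f. f \<in> duality_set (x - y)} \<noteq> {}"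
    using duality_set_nonempty[of "0 - 0"] by blast
next
  fix a assume "a \<in> {\<bar>f (S x - S y)\<bar> / (norm (x - y))\<^sup>2 |x y f. f \<in> duality_set (x - y)}"
  then obtain x y f where f: "f \<in> duality_set (x - y)"
    and a: "a = \<bar>f (S x - S y)\<bar> / (norm (x - y))\<^sup>2" by blast
  show "a \<le> lin_numrange S"
  proof (cases "x = y")
    case True
    with a lin_numrange_nonneg[OF S nz] show ?thesis by simp
  next
    case False
    define r where "r = inverse (norm (x - y))"
    have lin: "linear S" "linear f"
      using S f by (auto simp: duality_set_def bounded_linear.linear)
    have "\<bar>r * f (S (r *\<^sub>R (x - y)))\<bar> \<le> lin_numrange S"
      using False by (intro le_lin_numrange[OF S _ duality_set_scaleR[OF f]]) (simp add: r_def)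
    also have "r * f (S (r *\<^sub>R (x - y))) = r\<^sup>2 * f (S x - S y)"
      using lin by (simp add: linear_scale linear_diff power2_eq_square)
    also have "\<bar>\<dots>\<bar> = a"
      by (simp add: a r_def abs_mult power_inverse divide_inverse mult.commute)
    finally show ?thesis .
  qed
qed

lemma lip_norm_bounded_linear:
  assumes "bounded_linear S"
  shows "lip_norm S = onorm S"
proof -
  have "range (\<lambda>p. norm (S (fst p) - S (snd p)) / norm (fst p - snd p))
      = range (\<lambda>x. norm (S x) / norm x)" (is "?A = ?B")
  proof (intro antisym subsetI)
    fix a assume "a \<in> ?A"
    then obtain p where "a = norm (S (fst p - snd p)) / norm (fst p - snd p)"
      using linear_diff[OF bounded_linear.linear[OF assms]] by auto
    then show "a \<in> ?B" by blast
  next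
    fix a assume "a \<in> ?B"
    then obtain x where "a = norm (S x) / norm x" by blast
    then have "a = norm (S (fst (x, 0)) - S (snd (x, 0))) / norm (fst (x, 0) - snd (x, 0))"
      using linear_0[OF bounded_linear.linear[OF assms]] by simp
    then show "a \<in> ?A" by blast
  qed
  then show ?thesis by (simp add: lip_norm_def onorm_def)
qed

lemma bounded_linear_Lip0:
  assumes S: "bounded_linear S"
  shows "S \<in> Lip0"
proof -
  have "(onorm S)-lipschitz_on UNIV S"
    using onorm[OF S] linear_diff[OF bounded_linear.linear[OF S]]
    by (intro norm_lipschitzI onorm_pos_le[OF S]) metis
  then show ?thesis
    using linear_0[OF bounded_linear.linear[OF S]] by (auto simp: Lip0_def)
qed

lemma Lip0_slopes:
  assumes T: "T \<in> Lip0" "lip_norm T = 1"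
  shows Lip0_nonexpansive: "1-lipschitz_on UNIV T"
    and Lip0_large_slope: "c < 1 \<Longrightarrow> \<exists>x y. c * norm (x - y) < norm (T x - T y)"
proof -
  let ?q = "\<lambda>p. norm (T (fst p) - T (snd p)) / norm (fst p - snd p)"
  obtain C where C: "C-lipschitz_on UNIV T" using T(1) by (auto simp: Lip0_def)
  have bdd: "bdd_above (range ?q)"
  proof (rule bdd_aboveI2)
    fix p
    show "?q p \<le> C"
      using norm_lipschitz[OF C, of "fst p" "snd p"] lipschitz_on_nonneg[OF C]
      by (cases "fst p = snd p") (simp_all add: pos_divide_le_eq)
  qed
  show "1-lipschitz_on UNIV T"
  proof (rule norm_lipschitzI)
    fix x y
    have "?q (x, y) \<le> 1"
      using cSUP_upper[OF UNIV_I bdd, of "(x, y)"] T(2) by (simp add: lip_norm_def)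
    then show "norm (T x - T y) \<le> 1 * norm (x - y)"
      by (cases "x = y") (simp_all add: divide_le_eq_1)
  qed simp
  assume "c < 1"
  \<comment> \<open>The cutoff at \<open>0\<close> forces the pair found to consist of distinct
    points, since diagonal quotients are \<open>0\<close>.\<close>
  then have "max 0 c < (SUP p. ?q p)" using T(2) by (simp add: lip_norm_def)
  then obtain p where p: "max 0 c < ?q p"
    using less_cSUP_iff[OF UNIV_not_empty bdd] by auto
  then have "fst p \<noteq> snd p" by auto
  with p have "c * norm (fst p - snd p) < norm (T (fst p) - T (snd p))"
    by (simp add: pos_less_divide_eq)
  then show "\<exists>x y. c * norm (x - y) < norm (T x - T y)" by blast
qed

text \<open>The derivative found has norm above \<open>c\<close>, so dividing by its norm enlarges
  the numerical range bound by a factor less than \<open>1 / c\<close>.\<close>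

lemma normalized_linear_numrange:
  fixes T :: "'a::banach \<Rightarrow> 'a"
  assumes sep: "countable D" "closure D = (UNIV :: 'a set)"
    and T: "T \<in> Lip0" "lip_norm T = 1" and c: "0 < c" "c < 1"
  obtains S :: "'a \<Rightarrow> 'a" where "bounded_linear S" "onorm S = 1"
    "lin_numrange S \<le> lip_numrange T / c"
proof -
  note T1 = Lip0_nonexpansive[OF T]
  obtain x y where xy: "c * norm (x - y) < norm (T x - T y)"
    using Lip0_large_slope[OF T c(2)] by blast
  obtain S :: "'a \<Rightarrow> 'a" where S: "bounded_linear S" "c < onorm S"
    and le: "\<And>v f. f \<in> duality_set v \<Longrightarrow> \<bar>f (S v)\<bar> \<le> lip_numrange T * (norm v)\<^sup>2"
    by (rule linear_with_large_norm[OF sep T1 numrange_le_lip_numrange[OF T1] xy]) (rule that; blast)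
  define R where "R v = S v /\<^sub>R onorm S" for v
  have R: "bounded_linear R"
    unfolding R_def by (rule bounded_linear_const_scaleR[OF S(1)])
  have R1: "onorm R = 1"
    unfolding R_def using onorm_scaleR[OF S(1), of "inverse (onorm S)"] S(2) c by simp
  obtain u :: 'a where "u \<noteq> 0"
    using onorm_nonzero_obtains_nonzero[of S] linear_0[OF bounded_linear.linear[OF S(1)]] S(2) c by force
  then obtain z :: 'a and g where zg: "norm z = 1" "g \<in> duality_set z"
    by (rule unit_vector_with_duality)
  have "lin_numrange R \<le> lip_numrange T / c"
    unfolding lin_numrange_def
  proof (rule cSup_least)
    show "{\<bar>f (R x)\<bar> |x f. norm x = 1 \<and> f \<in> duality_set x} \<noteq> {}"
      using zg by blast
    fix a assume "a \<in> {\<bar>f (R x)\<bar> |x f. norm x = 1 \<and> f \<in> duality_set x}"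
    then obtain x f where a: "a = \<bar>f (R x)\<bar>" and x: "norm x = 1" and f: "f \<in> duality_set x"
      by blast
    have "linear f" using f by (simp add: duality_set_def bounded_linear.linear)
    then have "a = \<bar>f (S x)\<bar> / onorm S"
      using S(2) c by (simp add: a R_def linear_scale abs_mult divide_inverse)
    also have "\<dots> \<le> lip_numrange T / onorm S"
      using le[OF f] x S(2) c by (intro divide_right_mono) auto
    also have "\<dots> \<le> lip_numrange T / c"
      using lip_numrange_nonneg[OF T1] S(2) c by (intro divide_left_mono) auto
    finally show "a \<le> lip_numrange T / c" .
  qed
  with R R1 show thesis by (rule that)
qed

theorem theorem3p4:
  assumes "\<exists>S :: 'a::banach set. countable S \<and> closure S = UNIV"
    and "RNP TYPE('a)"
  shows "lip_numindex TYPE('a) = numindex TYPE('a)"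
proof -
  obtain D :: "'a set" where D: "countable D" "closure D = UNIV" using assms(1) by blast
  let ?A = "{lip_numrange T | T :: 'a \<Rightarrow> 'a. T \<in> Lip0 \<and> lip_norm T = 1}"
  let ?B = "{lin_numrange T | T :: 'a \<Rightarrow> 'a. bounded_linear T \<and> onorm T = 1}"
  have A_bdd: "bdd_below ?A"
    by (rule bdd_belowI[of _ 0]) (use Lip0_nonexpansive lip_numrange_nonneg in blast)
  have B_bdd: "bdd_below ?B"
    by (rule bdd_belowI[of _ 0]) (auto intro: lin_numrange_nonneg)
  have A_of_B: "\<exists>a\<in>?A. a \<le> b" if "b \<in> ?B" for b
  proof -
    from that obtain S :: "'a \<Rightarrow> 'a" where S: "bounded_linear S" "onorm S = 1" "b = lin_numrange S"
      by blast
    with lip_numrange_le_lin_numrange[OF S(1)] bounded_linear_Lip0[OF S(1)]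
      lip_norm_bounded_linear[OF S(1)] show ?thesis by auto
  qed
  have B_of_A: "\<exists>b\<in>?B. b \<le> a / c" if "a \<in> ?A" "0 < c" "c < 1" for a c
  proof -
    from that(1) obtain T :: "'a \<Rightarrow> 'a" where T: "T \<in> Lip0" "lip_norm T = 1" "a = lip_numrange T"
      by blast
    from normalized_linear_numrange[OF D T(1,2) that(2,3)] T(3) show ?thesis by blast
  qed
  have "Inf ?A = Inf ?B"
  proof (cases "?B = {}")
    case True
    \<comment> \<open>Without linear operators of norm one there are no Lipschitz maps of norm one
      either, and both sides are the infimum of the empty set.\<close>
    then have "?A = {}" using B_of_A[of _ "1/2"] by fastforce
    with True show ?thesis by presburger
  next
    case False
    then have A_ne: "?A \<noteq> {}" using A_of_B by blast
    show ?thesis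
    proof (rule antisym)
      show "Inf ?A \<le> Inf ?B"
        by (rule cInf_mono[OF False A_bdd A_of_B])
      show "Inf ?B \<le> Inf ?A"
      proof (rule cInf_greatest[OF A_ne])
        fix a assume a: "a \<in> ?A"
        \<comment> \<open>Derivatives are only known to have norm above \<open>c\<close>, so the
          comparison is made for every \<open>c < 1\<close> and the factor is removed at the
          end.\<close>
        have le: "c * Inf ?B \<le> a" if c: "0 < c" "c < 1" for c
        proof -
          obtain b where b: "b \<in> ?B" "b \<le> a / c" using B_of_A[OF a c] by blast
          have "Inf ?B \<le> a / c" using cInf_lower[OF b(1) B_bdd] b(2) by (rule order_trans)
          then show ?thesis using c by (simp add: pos_le_divide_eq mult.commute)
        qed
        show "Inf ?B \<le> a" by (rule field_le_mult_one_interval[OF le])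
      qed
    qed
  qed
  then show ?thesis unfolding lip_numindex_def numindex_def .
qed

end
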